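(* Let $K$ and $\alpha$ be formulas of $\mathcal{L}_{\mathcal{P}}$. Then $$Cn(K)\,\dot{-}\,\alpha \;=\; Cn\bigl(\lfloor (Cn(K),\emptyset,\{\neg\alpha\})\rfloor\bigr),$$ and this is logically equivalent to $\lfloor (K,\emptyset,\{\neg\alpha\})\rfloor$, i.e. $Cn(K)\dot{-}\alpha=Cn\bigl(\lfloor (K,\emptyset,\{\neg\alpha\})\rfloor\bigr)$.
   Context: $\mathcal{L}_{\mathcal{P}}$ is the classical propositional language (with constants $\top,\bot$) over a set $\mathcal{P}$ of atoms, $\vdash$ is classical consequence, and $Cn(\cdot)$ is deductive closure in $\mathcal{L}_{\mathcal P}$ (or, where primed atoms occur, in $\mathcal{L}_{\mathcal{P}\cup\mathcal{P}'}$). $\mathcal{P}'=\{p'\mid p\in\mathcal{P}\}$ is a disjoint copy of $\mathcal{P}$. For a set of formulas $K$ of $\mathcal{L}_{\mathcal P}$, $K'$ is the result of replacing each atom $p$ by $p'$. A formula $K$ is identified with $\{K\}$ where a set is required. A belief change scenario is a triple $B=(K,U,V)$ of sets of formulas of $\mathcal{L}_{\mathcal{P}}$. Let $(EQ_i)_{i\in I}$ be the family of all sets $EQ\subseteq\{p\equiv p'\mid p\in\mathcal{P}\}$ that are maximal with respect to inclusion such that $K'\cup EQ\cup U\cup V\not\vdash\bot$. The sets $E_i=Cn(K'\cup EQ_i\cup U)\cap\mathcal{L}_{\mathcal{P}}$, $i\in I$, are the consistent definitional extensions of $B$. Contraction: for a deductively closed $K$ and a formula $\alpha$, $K\dot{-}\alpha=\bigcap_{i\in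 I}E_i$, where $(E_i)_{i\in I}$ is the family of all consistent definitional extensions of $(K,\emptyset,\{\neg\alpha\})$; the intersection of the empty family is $\mathcal{L}_{\mathcal{P}}$. For $i\in I$ let $\mathcal{P}_{\overline{EQ_i}}=\{p\in\mathcal{P}\mid (p\equiv p')\notin EQ_i\}$ and let $\Pi_i$ be the set of all functions $\pi:\mathcal{P}_{\overline{EQ_i}}\to\{\top,\bot\}$. For $\pi_j\in\Pi_i$ and a formula $s$, $\lfloor s\rfloor^{j}$ is the result of replacing in $s$ each atom $p\in\mathcal{P}_{\overline{EQ_i}}$ by $\pi_j(p)$. Define $\lfloor B\rfloor=\bigvee_{i\in I,\;\pi_j\in\Pi_i}\;\bigwedge_{s\in K}\lfloor s\rfloor^{j}$. When $K$ is infinite the conjunction is understood semantically (an interpretation satisfies it iff it satisfies all conjuncts), and $Cn$ of the resulting expression is the set of formulas of $\mathcal{L}_{\mathcal{P}}$ true in all interpretations satisfying it; the empty disjunction is $\bot$. *)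

theory Defs
  imports Main "HOL-Library.FuncSet"
begin

datatype (atoms: 'a) form =
    Atom 'a
  | Top
  | Bot
  | Neg "'a form"
  | And "'a form" "'a form"
  | Or "'a form" "'a form"
  | Imp "'a form" "'a form"
  | Iff "'a form" "'a form"

definition lang :: "'a set \<Rightarrow> 'a form set" where
  "lang A = {\<phi>. atoms \<phi> \<subseteq> A}"

text \<open>Classical natural deduction. Derivations may pass through formulas with arbitrary atoms of
  the type; classical logic being conservative in this respect, restricting the conclusion to a
  language, as in \<open>Cn\<close> below, is enough.\<close>

inductive derives :: "'a form set \<Rightarrow> 'a form \<Rightarrow> bool" (infix "\<turnstile>" 50) where
  Assm: "\<phi> \<in> X \<Longrightarrow> X \<turnstile> \<phi>"
| TopI: "X \<turnstile> Top"
| Contr: "insert (Neg \<phi>) X \<turnstile> Bot \<Longrightarrow> X \<turnstile> \<phi>"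
| NegI: "insert \<phi> X \<turnstile> Bot \<Longrightarrow> X \<turnstile> Neg \<phi>"
| NegE: "X \<turnstile> Neg \<phi> \<Longrightarrow> X \<turnstile> \<phi> \<Longrightarrow> X \<turnstile> Bot"
| AndI: "X \<turnstile> \<phi> \<Longrightarrow> X \<turnstile> \<psi> \<Longrightarrow> X \<turnstile> And \<phi> \<psi>"
| AndE1: "X \<turnstile> And \<phi> \<psi> \<Longrightarrow> X \<turnstile> \<phi>"
| AndE2: "X \<turnstile> And \<phi> \<psi> \<Longrightarrow> X \<turnstile> \<psi>"
| OrI1: "X \<turnstile> \<phi> \<Longrightarrow> X \<turnstile> Or \<phi> \<psi>"
| OrI2: "X \<turnstile> \<psi> \<Longrightarrow> X \<turnstile> Or \<phi> \<psi>"
| OrE: "X \<turnstile> Or \<phi> \<psi> \<Longrightarrow> insert \<phi> X \<turnstile> \<chi> \<Longrightarrow> insert \<psi> X \<turnstile> \<chi> \<Longrightarrow> X \<turnstile> \<chi>"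
| ImpI: "insert \<phi> X \<turnstile> \<psi> \<Longrightarrow> X \<turnstile> Imp \<phi> \<psi>"
| ImpE: "X \<turnstile> Imp \<phi> \<psi> \<Longrightarrow> X \<turnstile> \<phi> \<Longrightarrow> X \<turnstile> \<psi>"
| IffI: "insert \<phi> X \<turnstile> \<psi> \<Longrightarrow> insert \<psi> X \<turnstile> \<phi> \<Longrightarrow> X \<turnstile> Iff \<phi> \<psi>"
| IffE1: "X \<turnstile> Iff \<phi> \<psi> \<Longrightarrow> X \<turnstile> \<phi> \<Longrightarrow> X \<turnstile> \<psi>"
| IffE2: "X \<turnstile> Iff \<phi> \<psi> \<Longrightarrow> X \<turnstile> \<psi> \<Longrightarrow> X \<turnstile> \<phi>"

definition Cn :: "'a set \<Rightarrow> 'a form set \<Rightarrow> 'a form set" where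
  "Cn A X = {\<phi> \<in> lang A. X \<turnstile> \<phi>}"

text \<open>A belief change scenario is a triple \<open>(K, U, V)\<close>. Below, \<open>P\<close> is the set of atoms and
  \<open>pr\<close> sends an atom \<open>p\<close> to its primed copy \<open>p'\<close>; it is meant to be injective on \<open>P\<close>, with
  \<open>pr ` P\<close> disjoint from \<open>P\<close>. The set \<open>K'\<close> is \<open>map_form pr ` K\<close>.\<close>

type_synonym 'a scenario = "'a form set \<times> 'a form set \<times> 'a form set"

definition eq_atom :: "('a \<Rightarrow> 'a) \<Rightarrow> 'a \<Rightarrow> 'a form" where
  "eq_atom pr p = Iff (Atom p) (Atom (pr p))"

fun EQ_consistent :: "('a \<Rightarrow> 'a) \<Rightarrow> 'a scenario \<Rightarrow> 'a form set \<Rightarrow> bool" where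
  "EQ_consistent pr (K, U, V) EQ \<longleftrightarrow> \<not> (map_form pr ` K \<union> EQ \<union> U \<union> V \<turnstile> Bot)"

text \<open>The family \<open>(EQ\<^sub>i)\<close> is represented as the set of its members.\<close>

definition EQs :: "'a set \<Rightarrow> ('a \<Rightarrow> 'a) \<Rightarrow> 'a scenario \<Rightarrow> 'a form set set" where
  "EQs P pr B = {EQ. EQ \<subseteq> eq_atom pr ` P \<and> EQ_consistent pr B EQ \<and>
     (\<forall>EQ'. EQ' \<subseteq> eq_atom pr ` P \<and> EQ_consistent pr B EQ' \<and> EQ \<subseteq> EQ' \<longrightarrow> EQ' = EQ)}"

fun extension :: "'a set \<Rightarrow> ('a \<Rightarrow> 'a) \<Rightarrow> 'a scenario \<Rightarrow> 'a form set \<Rightarrow> 'a form set" where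
  "extension P pr (K, U, V) EQ = Cn (P \<union> pr ` P) (map_form pr ` K \<union> EQ \<union> U) \<inter> lang P"

definition cons_def_extensions :: "'a set \<Rightarrow> ('a \<Rightarrow> 'a) \<Rightarrow> 'a scenario \<Rightarrow> 'a form set set" where
  "cons_def_extensions P pr B = extension P pr B ` EQs P pr B"

text \<open>Intersecting with \<open>lang P\<close> only matters for the empty family.\<close>

definition contraction :: "'a set \<Rightarrow> ('a \<Rightarrow> 'a) \<Rightarrow> 'a form set \<Rightarrow> 'a form \<Rightarrow> 'a form set" where
  "contraction P pr K \<alpha> = lang P \<inter> \<Inter> (cons_def_extensions P pr (K, {}, {Neg \<alpha>}))"

definition free_atoms :: "'a set \<Rightarrow> ('a \<Rightarrow> 'a) \<Rightarrow> 'a form set \<Rightarrow> 'a set" where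
  "free_atoms P pr EQ = {p \<in> P. eq_atom pr p \<notin> EQ}"

primrec subst :: "('a \<Rightarrow> 'a form) \<Rightarrow> 'a form \<Rightarrow> 'a form" where
  "subst \<sigma> (Atom p) = \<sigma> p"
| "subst \<sigma> Top = Top"
| "subst \<sigma> Bot = Bot"
| "subst \<sigma> (Neg \<phi>) = Neg (subst \<sigma> \<phi>)"
| "subst \<sigma> (And \<phi> \<psi>) = And (subst \<sigma> \<phi>) (subst \<sigma> \<psi>)"
| "subst \<sigma> (Or \<phi> \<psi>) = Or (subst \<sigma> \<phi>) (subst \<sigma> \<psi>)"
| "subst \<sigma> (Imp \<phi> \<psi>) = Imp (subst \<sigma> \<phi>) (subst \<sigma> \<psi>)"
| "subst \<sigma> (Iff \<phi> \<psi>) = Iff (subst \<sigma> \<phi>) (subst \<sigma> \<psi>)"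

definition instantiate :: "'a set \<Rightarrow> ('a \<Rightarrow> 'a form) \<Rightarrow> 'a form \<Rightarrow> 'a form" where
  "instantiate Q \<pi> s = subst (\<lambda>p. if p \<in> Q then \<pi> p else Atom p) s"

text \<open>A possibly infinite disjunction of possibly infinite conjunctions of formulas is represented
  as the set of its disjuncts, each being the set of its conjuncts. The following is the expression
  \<open>\<lfloor>B\<rfloor>\<close>.\<close>

fun floor_expr :: "'a set \<Rightarrow> ('a \<Rightarrow> 'a) \<Rightarrow> 'a scenario \<Rightarrow> 'a form set set" where
  "floor_expr P pr (K, U, V) =
     {instantiate (free_atoms P pr EQ) \<pi> ` K | EQ \<pi>.
        EQ \<in> EQs P pr (K, U, V) \<and> \<pi> \<in> free_atoms P pr EQ \<rightarrow>\<^sub>E {Top, Bot}}"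

primrec sat :: "('a \<Rightarrow> bool) \<Rightarrow> 'a form \<Rightarrow> bool" where
  "sat M (Atom p) = M p"
| "sat M Top = True"
| "sat M Bot = False"
| "sat M (Neg \<phi>) = (\<not> sat M \<phi>)"
| "sat M (And \<phi> \<psi>) = (sat M \<phi> \<and> sat M \<psi>)"
| "sat M (Or \<phi> \<psi>) = (sat M \<phi> \<or> sat M \<psi>)"
| "sat M (Imp \<phi> \<psi>) = (sat M \<phi> \<longrightarrow> sat M \<psi>)"
| "sat M (Iff \<phi> \<psi>) = (sat M \<phi> \<longleftrightarrow> sat M \<psi>)"

definition sat_expr :: "('a \<Rightarrow> bool) \<Rightarrow> 'a form set set \<Rightarrow> bool" where
  "sat_expr M D \<longleftrightarrow> (\<exists>C \<in> D. \<forall>s \<in> C. sat M s)"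

definition Cn_expr :: "'a set \<Rightarrow> 'a form set set \<Rightarrow> 'a form set" where
  "Cn_expr P D = {\<phi> \<in> lang P. \<forall>M. sat_expr M D \<longrightarrow> sat M \<phi>}"

end

(* By completeness everything may be read semantically. Fix EQ and let Q be the set of atoms p whose
   equivalence with p' is not in EQ. A valuation M of the unprimed atoms extends to a model of
   K' and EQ iff K holds under M after the atoms in Q have been reassigned suitably: the value of p'
   is forced to be that of p outside Q, and is free on Q. The reassignments of Q are exactly the
   substitutions pi, so the extension determined by EQ is the set of consequences of the disjunction
   over pi. Finally, K and Cn(K) have the same models, so they yield the same maximal sets EQ and
   equivalent conjunctions. *)

theory Submission
  imports Defs
begin

section \<open>Monotonicity and compactness of derivability\<close>

lemma derives_mono:
  assumes "X \<turnstile> \<phi>" "X \<subseteq> Y"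
  shows "Y \<turnstile> \<phi>"
  using assms
proof (induction arbitrary: Y rule: derives.induct)
  case Assm
  then show ?case
    by (meson derives.Assm subsetD)
next
  case TopI
  show ?case
    by (rule derives.TopI)
next
  case Contr
  then show ?case
    by (meson derives.Contr insert_mono)
next
  case NegI
  then show ?case
    by (meson derives.NegI insert_mono)
next
  case NegE
  then show ?case
    by (meson derives.NegE)
next
  case AndI
  then show ?case
    by (meson derives.AndI)
next
  case AndE1
  then show ?case
    by (meson derives.AndE1)
next
  case AndE2
  then show ?case
    by (meson derives.AndE2)
next
  case OrI1
  then show ?case
    by (meson derives.OrI1)
next
  case OrI2
  then show ?case
    by (meson derives.OrI2)
next
  case (OrE X \<phi> \<psi> \<chi>)
  show ?case
    using OrE.IH(1)[OF OrE.prems] OrE.IH(2,3)[OF insert_mono[OF OrE.prems]] by (rule derives.OrE)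
next
  case ImpI
  then show ?case
    by (meson derives.ImpI insert_mono)
next
  case ImpE
  then show ?case
    by (meson derives.ImpE)
next
  case IffI
  then show ?case
    by (meson derives.IffI insert_mono)
next
  case IffE1
  then show ?case
    by (meson derives.IffE1)
next
  case IffE2
  then show ?case
    by (meson derives.IffE2)
qed

text \<open>Serves the rules that discharge an assumption: deleting the discharged
  \<open>\<phi>\<close> from the finite support of a premise leaves only formulas of
  \<open>X\<close>.\<close>

lemma derives_finite_insert:
  assumes "finite Y" "Y \<subseteq> insert \<phi> X" "Y \<turnstile> \<psi>"
  shows "\<exists>Z. finite Z \<and> Z \<subseteq> X \<and> insert \<phi> Z \<turnstile> \<psi>"
proof (intro exI conjI)
  show "finite (Y - {\<phi>})" "Y - {\<phi>} \<subseteq> X"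
    using assms by auto
  show "insert \<phi> (Y - {\<phi>}) \<turnstile> \<psi>"
    using assms(3) by (rule derives_mono) auto
qed

text \<open>Each rule has finitely many premises, so the union of their finite supports, with
  discharged assumptions removed, supports the conclusion.\<close>

lemma derives_compact:
  assumes "X \<turnstile> \<phi>"
  shows "\<exists>Y. finite Y \<and> Y \<subseteq> X \<and> Y \<turnstile> \<phi>"
  using assms
proof induction
  case (Assm \<phi> X)
  then show ?case
    by (intro exI[of _ "{\<phi>}"]) (auto intro: derives.Assm)
next
  case (TopI X)
  show ?case
    by (intro exI[of _ "{}"]) (auto intro: derives.TopI)
next
  case (Contr \<phi> X)
  then show ?case
    by (meson derives_finite_insert derives.Contr)
next
  case (NegI \<phi> X)
  then show ?case
    by (meson derives_finite_insert derives.NegI)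
next
  case (NegE X \<phi>)
  then obtain Y Z where "finite Y" "Y \<subseteq> X" "Y \<turnstile> Neg \<phi>" "finite Z" "Z \<subseteq> X" "Z \<turnstile> \<phi>"
    by blast
  then show ?case
    by (intro exI[of _ "Y \<union> Z"]) (auto intro: derives.NegE derives_mono)
next
  case (AndI X \<phi> \<psi>)
  then obtain Y Z where "finite Y" "Y \<subseteq> X" "Y \<turnstile> \<phi>" "finite Z" "Z \<subseteq> X" "Z \<turnstile> \<psi>"
    by blast
  then show ?case
    by (intro exI[of _ "Y \<union> Z"]) (auto intro: derives.AndI derives_mono)
next
  case (AndE1 X \<phi> \<psi>)
  then show ?case
    by (meson derives.AndE1)
next
  case (AndE2 X \<phi> \<psi>)
  then show ?case
    by (meson derives.AndE2)
next
  case (OrI1 X \<phi> \<psi>)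
  then show ?case
    by (meson derives.OrI1)
next
  case (OrI2 X \<psi> \<phi>)
  then show ?case
    by (meson derives.OrI2)
next
  case (OrE X \<phi> \<psi> \<chi>)
  then obtain Y Z W where fin: "finite Y" "Y \<subseteq> X" "finite Z" "Z \<subseteq> X" "finite W" "W \<subseteq> X"
    and der: "Y \<turnstile> Or \<phi> \<psi>" "insert \<phi> Z \<turnstile> \<chi>" "insert \<psi> W \<turnstile> \<chi>"
    by (meson derives_finite_insert)
  have "Y \<union> Z \<union> W \<turnstile> \<chi>"
    by (rule derives.OrE[of _ \<phi> \<psi>]) (rule derives_mono[OF der(1)] derives_mono[OF der(2)]
        derives_mono[OF der(3)], blast)+
  then show ?case
    using fin by (intro exI[of _ "Y \<union> Z \<union> W"]) auto
next
  case (ImpI \<phi> X \<psi>)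
  then show ?case
    by (meson derives_finite_insert derives.ImpI)
next
  case (ImpE X \<phi> \<psi>)
  then obtain Y Z where "finite Y" "Y \<subseteq> X" "Y \<turnstile> Imp \<phi> \<psi>" "finite Z" "Z \<subseteq> X" "Z \<turnstile> \<phi>"
    by blast
  then show ?case
    by (intro exI[of _ "Y \<union> Z"]) (auto intro: derives.ImpE derives_mono)
next
  case (IffI \<phi> X \<psi>)
  then obtain Y Z where fin: "finite Y" "Y \<subseteq> X" "finite Z" "Z \<subseteq> X"
    and der: "insert \<phi> Y \<turnstile> \<psi>" "insert \<psi> Z \<turnstile> \<phi>"
    by (meson derives_finite_insert)
  have "Y \<union> Z \<turnstile> Iff \<phi> \<psi>"
    by (rule derives.IffI) (rule derives_mono[OF der(1)] derives_mono[OF der(2)], blast)+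
  then show ?case
    using fin by (intro exI[of _ "Y \<union> Z"]) auto
next
  case (IffE1 X \<phi> \<psi>)
  then obtain Y Z where "finite Y" "Y \<subseteq> X" "Y \<turnstile> Iff \<phi> \<psi>" "finite Z" "Z \<subseteq> X" "Z \<turnstile> \<phi>"
    by blast
  then show ?case
    by (intro exI[of _ "Y \<union> Z"]) (auto intro: derives.IffE1 derives_mono)
next
  case (IffE2 X \<phi> \<psi>)
  then obtain Y Z where "finite Y" "Y \<subseteq> X" "Y \<turnstile> Iff \<phi> \<psi>" "finite Z" "Z \<subseteq> X" "Z \<turnstile> \<psi>"
    by blast
  then show ?case
    by (intro exI[of _ "Y \<union> Z"]) (auto intro: derives.IffE2 derives_mono)
qed

section \<open>Soundness and completeness\<close>

lemma derives_sound:
  assumes "X \<turnstile> \<phi>" "\<forall>\<psi>\<in>X. sat M \<psi>"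
  shows "sat M \<phi>"
  using assms by induction auto

text \<open>Lindenbaum's lemma by Zorn: a derivation of \<open>Bot\<close> from the union of a chain
  uses finitely many formulas, and these already lie in one member of the chain.\<close>

lemma consistent_extends_to_maximal:
  assumes "\<not> X \<turnstile> Bot"
  shows "\<exists>Z. X \<subseteq> Z \<and> \<not> Z \<turnstile> Bot \<and> (\<forall>\<phi>. \<phi> \<notin> Z \<longrightarrow> insert \<phi> Z \<turnstile> Bot)"
proof -
  let ?A = "{Z. X \<subseteq> Z \<and> \<not> Z \<turnstile> Bot}"
  have "\<Union>C \<in> ?A" if "C \<noteq> {}" "subset.chain ?A C" for C
  proof -
    have "\<not> \<Union>C \<turnstile> Bot"
    proof
      assume "\<Union>C \<turnstile> Bot"
      then obtain Y where "finite Y" "Y \<subseteq> \<Union>C" "Y \<turnstile> Bot"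
        using derives_compact by blast
      then obtain Z where "Z \<in> C" "Y \<subseteq> Z"
        using finite_subset_Union_chain \<open>C \<noteq> {}\<close> \<open>subset.chain ?A C\<close> by metis
      then show False
        using derives_mono[OF \<open>Y \<turnstile> Bot\<close>] \<open>subset.chain ?A C\<close> by (auto simp: subset.chain_def)
    qed
    then show ?thesis
      using that unfolding subset.chain_def by blast
  qed
  then obtain Z where "Z \<in> ?A" "\<forall>Y\<in>?A. Z \<subseteq> Y \<longrightarrow> Y = Z"
    using subset_Zorn_nonempty[of ?A] assms by blast
  \<comment> \<open>For \<open>\<phi> \<notin> Z\<close>, the set \<open>insert \<phi> Z\<close> is
    a proper superset of \<open>Z\<close> containing \<open>X\<close>. By maximality it is outside
    \<open>?A\<close>, so it is inconsistent.\<close>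
  then show ?thesis
    by (intro exI[of _ Z]) blast
qed

text \<open>The canonical valuation of a maximal consistent superset \<open>Z\<close>, true at
  exactly the atoms in \<open>Z\<close>, satisfies exactly the members of \<open>Z\<close>.\<close>

lemma consistent_satisfiable:
  assumes "\<not> X \<turnstile> Bot"
  shows "\<exists>M. \<forall>\<phi>\<in>X. sat M \<phi>"
proof -
  obtain Z where Z: "X \<subseteq> Z" "\<not> Z \<turnstile> Bot" "\<And>\<phi>. \<phi> \<notin> Z \<Longrightarrow> insert \<phi> Z \<turnstile> Bot"
    using consistent_extends_to_maximal[OF assms] by blast
  \<comment> \<open>Once \<open>Z\<close> is known to be deductively closed, every inference rule
    becomes a closure condition on membership in \<open>Z\<close>.\<close>
  have mem: "Z \<turnstile> \<phi> \<longleftrightarrow> \<phi> \<in> Z" for \<phi>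
  proof
    show "\<phi> \<in> Z" if "Z \<turnstile> \<phi>"
    proof (rule ccontr)
      assume "\<phi> \<notin> Z"
      then have "Z \<turnstile> Neg \<phi>"
        by (intro derives.NegI Z(3))
      then show False
        using that Z(2) derives.NegE by metis
    qed
  qed (rule derives.Assm)
  have neg: "Neg \<phi> \<in> Z \<longleftrightarrow> \<phi> \<notin> Z" for \<phi>
  proof
    show "\<phi> \<notin> Z" if "Neg \<phi> \<in> Z"
      using derives.NegE[of Z \<phi>] that Z(2) by (auto simp: mem)
    show "Neg \<phi> \<in> Z" if "\<phi> \<notin> Z"
      using derives.NegI[OF Z(3)[OF that]] by (simp add: mem)
  qed
  \<comment> \<open>This and \<open>weaken\<close> supply the subderivations for introducing
    \<open>Imp\<close> and \<open>Iff\<close>: either the antecedent is outside \<open>Z\<close> or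
    the consequent is in \<open>Z\<close>.\<close>
  have explosion: "insert \<phi> Z \<turnstile> \<chi>" if "\<phi> \<notin> Z" for \<phi> \<chi>
    by (rule derives.Contr, rule derives_mono[OF Z(3)[OF that]]) auto
  have weaken: "insert \<phi> Z \<turnstile> \<psi>" if "\<psi> \<in> Z" for \<phi> \<psi>
    using that by (intro derives.Assm) simp
  have "sat (\<lambda>p. Atom p \<in> Z) \<phi> \<longleftrightarrow> \<phi> \<in> Z" for \<phi>
  proof (induction \<phi>)
    case Top
    show ?case
      using derives.TopI[of Z] by (simp add: mem)
  next
    case Bot
    show ?case
      using Z(2) by (simp add: mem)
  next
    case (Neg \<phi>)
    then show ?case
      using neg by simp
  next
    case (And \<phi> \<psi>)
    have "And \<phi> \<psi> \<in> Z \<longleftrightarrow> \<phi> \<in> Z \<and> \<psi> \<in> Z"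
      using derives.AndI[of Z \<phi> \<psi>] derives.AndE1[of Z \<phi> \<psi>] derives.AndE2[of Z \<phi> \<psi>]
      by (auto simp: mem)
    then show ?case
      using And by simp
  next
    case (Or \<phi> \<psi>)
    \<comment> \<open>If both disjuncts were outside \<open>Z\<close>, each would yield
      \<open>Bot\<close> when added, and \<open>OrE\<close> would refute \<open>Z\<close>.\<close>
    have "\<phi> \<in> Z \<or> \<psi> \<in> Z" if "Z \<turnstile> Or \<phi> \<psi>"
      using derives.OrE[OF that, of Bot] Z(2,3) by blast
    then have "Or \<phi> \<psi> \<in> Z \<longleftrightarrow> \<phi> \<in> Z \<or> \<psi> \<in> Z"
      using derives.OrI1[of Z \<phi> \<psi>] derives.OrI2[of Z \<psi> \<phi>] by (auto simp: mem)
    then show ?case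
      using Or by simp
  next
    case (Imp \<phi> \<psi>)
    have "Z \<turnstile> Imp \<phi> \<psi>" if "\<phi> \<in> Z \<longrightarrow> \<psi> \<in> Z"
      by (rule derives.ImpI) (use that explosion weaken in blast)
    then have "Imp \<phi> \<psi> \<in> Z \<longleftrightarrow> (\<phi> \<in> Z \<longrightarrow> \<psi> \<in> Z)"
      using derives.ImpE[of Z \<phi> \<psi>] by (auto simp: mem)
    then show ?case
      using Imp by simp
  next
    case (Iff \<phi> \<psi>)
    have "Z \<turnstile> Iff \<phi> \<psi>" if "\<phi> \<in> Z \<longleftrightarrow> \<psi> \<in> Z"
      by (rule derives.IffI) (use that explosion weaken in blast)+
    then have "Iff \<phi> \<psi> \<in> Z \<longleftrightarrow> (\<phi> \<in> Z \<longleftrightarrow> \<psi> \<in> Z)"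
      using derives.IffE1[of Z \<phi> \<psi>] derives.IffE2[of Z \<phi> \<psi>] unfolding mem by blast
    then show ?case
      using Iff by simp
  qed simp
  then show ?thesis
    using Z(1) by blast
qed

lemma derives_Bot_iff: "X \<turnstile> Bot \<longleftrightarrow> \<not> (\<exists>M. \<forall>\<phi>\<in>X. sat M \<phi>)"
  using consistent_satisfiable[of X] derives_sound[of X Bot] by auto

lemma derives_iff: "X \<turnstile> \<phi> \<longleftrightarrow> (\<forall>M. (\<forall>\<psi>\<in>X. sat M \<psi>) \<longrightarrow> sat M \<phi>)"
proof
  show "X \<turnstile> \<phi> \<Longrightarrow> \<forall>M. (\<forall>\<psi>\<in>X. sat M \<psi>) \<longrightarrow> sat M \<phi>"
    using derives_sound by blast
  assume "\<forall>M. (\<forall>\<psi>\<in>X. sat M \<psi>) \<longrightarrow> sat M \<phi>"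
  then have "insert (Neg \<phi>) X \<turnstile> Bot"
    by (auto simp: derives_Bot_iff)
  then show "X \<turnstile> \<phi>"
    by (rule derives.Contr)
qed

section \<open>Renaming, substitution and closure under valuations\<close>

lemma sat_cong: "(\<And>p. p \<in> atoms \<phi> \<Longrightarrow> M p = N p) \<Longrightarrow> sat M \<phi> = sat N \<phi>"
  by (induction \<phi>) auto

lemma sat_map_form: "sat M (map_form f \<phi>) = sat (M \<circ> f) \<phi>"
  by (induction \<phi>) auto

lemma sat_subst: "sat M (subst \<sigma> \<phi>) = sat (\<lambda>p. sat M (\<sigma> p)) \<phi>"
  by (induction \<phi>) auto

lemma sat_eq_atom: "sat M (eq_atom pr p) \<longleftrightarrow> M p = M (pr p)"
  by (simp add: eq_atom_def)

text \<open>Soundness gives one direction. For the other, the language hypothesis puts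
  \<open>X\<close> inside \<open>Cn P X\<close>, which keeps only formulas over
  \<open>P\<close>.\<close>

lemma sat_Cn:
  assumes "X \<subseteq> lang P"
  shows "(\<forall>\<phi>\<in>Cn P X. sat M \<phi>) \<longleftrightarrow> (\<forall>\<phi>\<in>X. sat M \<phi>)"
proof
  have "X \<subseteq> Cn P X"
    using assms by (auto simp: Cn_def intro: derives.Assm)
  then show "\<forall>\<phi>\<in>Cn P X. sat M \<phi> \<Longrightarrow> \<forall>\<phi>\<in>X. sat M \<phi>"
    by blast
  show "\<forall>\<phi>\<in>X. sat M \<phi> \<Longrightarrow> \<forall>\<phi>\<in>Cn P X. sat M \<phi>"
    by (auto simp: Cn_def dest: derives_sound)
qed

section \<open>Models of the floor expression and of the extensions\<close>

text \<open>By \<open>sat_subst\<close> an instantiation of the formulas becomes a change of the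
  valuation at which the original formulas are read.\<close>

lemma sat_floor_expr:
  "sat_expr M (floor_expr P pr (X, U, V)) \<longleftrightarrow>
     (\<exists>EQ\<in>EQs P pr (X, U, V). \<exists>\<pi>\<in>free_atoms P pr EQ \<rightarrow>\<^sub>E {Top, Bot}.
        \<forall>s\<in>X. sat (\<lambda>p. sat M (if p \<in> free_atoms P pr EQ then \<pi> p else Atom p)) s)"
proof -
  let ?inst = "\<lambda>EQ \<pi>. instantiate (free_atoms P pr EQ) \<pi> ` X"
  have "sat_expr M (floor_expr P pr (X, U, V)) \<longleftrightarrow>
      (\<exists>EQ\<in>EQs P pr (X, U, V). \<exists>\<pi>\<in>free_atoms P pr EQ \<rightarrow>\<^sub>E {Top, Bot}. \<forall>t\<in>?inst EQ \<pi>. sat M t)"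
    unfolding sat_expr_def floor_expr.simps by blast
  then show ?thesis
    by (simp only: ball_simps instantiate_def sat_subst)
qed

text \<open>A choice of \<pi> and a choice of values for the primed copies of the atoms in
  \<open>Q\<close> carry the same information, and the two directions translate one into the
  other.\<close>

lemma instantiation_iff_extension_model:
  fixes M :: "'a \<Rightarrow> bool"
  assumes "inj_on pr P" "pr ` P \<inter> P = {}" "X \<subseteq> lang P" "EQ \<subseteq> eq_atom pr ` P"
  defines "Q \<equiv> free_atoms P pr EQ"
  shows "(\<exists>\<pi>\<in>Q \<rightarrow>\<^sub>E {Top, Bot}. \<forall>s\<in>X. sat (\<lambda>p. sat M (if p \<in> Q then \<pi> p else Atom p)) s) \<longleftrightarrow>
    (\<exists>N. (\<forall>p\<in>P. N p = M p) \<and> (\<forall>\<phi>\<in>map_form pr ` X \<union> EQ. sat N \<phi>))"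
proof
  assume "\<exists>\<pi>\<in>Q \<rightarrow>\<^sub>E {Top, Bot}. \<forall>s\<in>X. sat (\<lambda>p. sat M (if p \<in> Q then \<pi> p else Atom p)) s"
  then obtain \<pi> where \<pi>: "\<forall>s\<in>X. sat (\<lambda>p. sat M (if p \<in> Q then \<pi> p else Atom p)) s"
    by blast
  \<comment> \<open>Atoms of \<open>P\<close> keep their value, and \<open>pr p\<close> takes the
    value of \<open>p\<close> after instantiation. Injectivity recovers \<open>p\<close> from
    \<open>pr p\<close>, and disjointness keeps the two clauses apart. Atoms outside both copies get
    an arbitrary value, since no formula in question mentions them.\<close>
  define N where "N q = (if q \<in> P then M q
    else let p = the_inv_into P pr q in sat M (if p \<in> Q then \<pi> p else Atom p))" for q
  have N: "N (pr p) = sat M (if p \<in> Q then \<pi> p else Atom p)" if "p \<in> P" for p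
    using that assms(1,2) by (auto simp: N_def the_inv_into_f_f)
  have "sat N (map_form pr s)" if "s \<in> X" for s
  proof -
    have "sat (N \<circ> pr) s = sat (\<lambda>p. sat M (if p \<in> Q then \<pi> p else Atom p)) s"
      unfolding o_def by (rule sat_cong, rule N) (use that assms(3) in \<open>auto simp: lang_def\<close>)
    then show ?thesis
      using \<pi> that by (simp add: sat_map_form)
  qed
  moreover have "sat N \<phi>" if "\<phi> \<in> EQ" for \<phi>
  proof -
    obtain p where p: "p \<in> P" "\<phi> = eq_atom pr p"
      using \<open>\<phi> \<in> EQ\<close> assms(4) by blast
    then have "p \<notin> Q"
      using that by (simp add: Q_def free_atoms_def)
    then show ?thesis
      using p N by (simp add: sat_eq_atom) (simp add: N_def)
  qed
  moreover have "\<forall>p\<in>P. N p = M p"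
    by (simp add: N_def)
  ultimately show "\<exists>N. (\<forall>p\<in>P. N p = M p) \<and> (\<forall>\<phi>\<in>map_form pr ` X \<union> EQ. sat N \<phi>)"
    by blast
next
  assume "\<exists>N. (\<forall>p\<in>P. N p = M p) \<and> (\<forall>\<phi>\<in>map_form pr ` X \<union> EQ. sat N \<phi>)"
  then obtain N where N: "\<forall>p\<in>P. N p = M p" "\<forall>s\<in>X. sat (N \<circ> pr) s" "\<forall>\<phi>\<in>EQ. sat N \<phi>"
    by (metis UnI1 UnI2 image_eqI sat_map_form)
  \<comment> \<open>\<pi> reads off the truth value of the primed copy. The abstraction is
    restricted to \<open>Q\<close> because \<pi> must lie in the extensional function space.\<close>
  define \<pi> where "\<pi> = (\<lambda>p\<in>Q. if N (pr p) then Top else Bot :: 'a form)"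
  have val: "sat M (if p \<in> Q then \<pi> p else Atom p) = (N \<circ> pr) p" if "p \<in> P" for p
  proof (cases "p \<in> Q")
    case True
    then show ?thesis
      by (simp add: \<pi>_def)
  next
    case False
    then have "sat N (eq_atom pr p)"
      using that N(3) by (auto simp: Q_def free_atoms_def)
    then show ?thesis
      using that False N(1) by (simp add: sat_eq_atom)
  qed
  have "\<forall>s\<in>X. sat (\<lambda>p. sat M (if p \<in> Q then \<pi> p else Atom p)) s"
  proof
    fix s assume s: "s \<in> X"
    have "sat (\<lambda>p. sat M (if p \<in> Q then \<pi> p else Atom p)) s = sat (N \<circ> pr) s"
      by (rule sat_cong, rule val) (use s assms(3) in \<open>auto simp: lang_def\<close>)
    then show "sat (\<lambda>p. sat M (if p \<in> Q then \<pi> p else Atom p)) s"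
      using N(2) s by simp
  qed
  moreover have "\<pi> \<in> Q \<rightarrow>\<^sub>E {Top, Bot}"
    by (auto simp: \<pi>_def)
  ultimately show
    "\<exists>\<pi>\<in>Q \<rightarrow>\<^sub>E {Top, Bot}. \<forall>s\<in>X. sat (\<lambda>p. sat M (if p \<in> Q then \<pi> p else Atom p)) s"
    by blast
qed

text \<open>A formula over \<open>P\<close> has the same value in valuations that agree on
  \<open>P\<close>, so its truth in all models \<open>N\<close> is its truth in every
  \<open>M\<close> that some such \<open>N\<close> matches on \<open>P\<close>.\<close>

lemma extension_iff:
  assumes "\<phi> \<in> lang P"
  shows "\<phi> \<in> extension P pr (X, {}, V) EQ \<longleftrightarrow>
    (\<forall>M. (\<exists>N. (\<forall>p\<in>P. N p = M p) \<and> (\<forall>\<psi>\<in>map_form pr ` X \<union> EQ. sat N \<psi>)) \<longrightarrow> sat M \<phi>)"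
proof -
  have "sat N \<phi> = sat M \<phi>" if "\<forall>p\<in>P. N p = M p" for M N
    using that assms by (intro sat_cong) (auto simp: lang_def)
  moreover have "\<phi> \<in> extension P pr (X, {}, V) EQ \<longleftrightarrow> map_form pr ` X \<union> EQ \<turnstile> \<phi>"
    using assms by (auto simp: Cn_def lang_def)
  ultimately show ?thesis
    unfolding derives_iff by metis
qed

section \<open>Contraction as the consequences of the floor expression\<close>

text \<open>Intersecting consequence sets corresponds to uniting model classes, that is, to a
  disjunction over EQ. For an empty family both sides are \<open>lang P\<close>: nothing is
  intersected on the left, and the empty disjunction has no model.\<close>

lemma contraction_eq_floor:
  assumes "inj_on pr P" "pr ` P \<inter> P = {}" "X \<subseteq> lang P"
  shows "contraction P pr X \<alpha> = Cn_expr P (floor_expr P pr (X, {}, {Neg \<alpha>}))"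
proof (rule set_eqI)
  fix \<phi>
  let ?E = "EQs P pr (X, {}, {Neg \<alpha>})"
  have EQ: "EQ \<subseteq> eq_atom pr ` P" if "EQ \<in> ?E" for EQ
    using that unfolding EQs_def by blast
  have "\<phi> \<in> contraction P pr X \<alpha> \<longleftrightarrow>
      \<phi> \<in> lang P \<and> (\<forall>EQ\<in>?E. \<phi> \<in> extension P pr (X, {}, {Neg \<alpha>}) EQ)"
    by (simp add: contraction_def cons_def_extensions_def del: extension.simps)
  also have "\<dots> \<longleftrightarrow> \<phi> \<in> lang P \<and>
      (\<forall>M. sat_expr M (floor_expr P pr (X, {}, {Neg \<alpha>})) \<longrightarrow> sat M \<phi>)"
  proof (intro conj_cong refl)
    assume \<phi>: "\<phi> \<in> lang P"
    define ext where "ext EQ M \<longleftrightarrow>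
      (\<exists>N. (\<forall>p\<in>P. N p = M p) \<and> (\<forall>\<psi>\<in>map_form pr ` X \<union> EQ. sat N \<psi>))" for EQ M
    have "sat_expr M (floor_expr P pr (X, {}, {Neg \<alpha>})) \<longleftrightarrow> (\<exists>EQ\<in>?E. ext EQ M)" for M
      unfolding sat_floor_expr ext_def
      by (rule bex_cong[OF refl instantiation_iff_extension_model[OF assms EQ]])
    moreover have "\<phi> \<in> extension P pr (X, {}, {Neg \<alpha>}) EQ \<longleftrightarrow> (\<forall>M. ext EQ M \<longrightarrow> sat M \<phi>)" for EQ
      unfolding ext_def by (rule extension_iff[OF \<phi>])
    \<comment> \<open>The quantifiers over EQ and \<open>M\<close> commute, and the one over EQ then
      becomes an existential in the premise.\<close>
    ultimately show "(\<forall>EQ\<in>?E. \<phi> \<in> extension P pr (X, {}, {Neg \<alpha>}) EQ) \<longleftrightarrow>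
        (\<forall>M. sat_expr M (floor_expr P pr (X, {}, {Neg \<alpha>})) \<longrightarrow> sat M \<phi>)"
      by (simp only:) blast
  qed
  finally show "\<phi> \<in> contraction P pr X \<alpha> \<longleftrightarrow>
      \<phi> \<in> Cn_expr P (floor_expr P pr (X, {}, {Neg \<alpha>}))"
    by (simp add: Cn_expr_def)
qed

section \<open>Replacing a set of formulas by its closure\<close>

lemma EQ_consistent_Cn:
  assumes "X \<subseteq> lang P"
  shows "EQ_consistent pr (Cn P X, U, V) EQ = EQ_consistent pr (X, U, V) EQ"
proof -
  \<comment> \<open>Reading a primed formula at \<open>M\<close> is reading the unprimed one at
    \<open>M \<circ> pr\<close>, and there \<open>sat_Cn\<close> applies.\<close>
  have "(\<forall>\<phi>\<in>map_form pr ` Cn P X \<union> EQ \<union> U \<union> V. sat M \<phi>) \<longleftrightarrow>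
      (\<forall>\<phi>\<in>map_form pr ` X \<union> EQ \<union> U \<union> V. sat M \<phi>)" for M
    using sat_Cn[OF assms, of "M \<circ> pr"] by (simp add: ball_Un sat_map_form)
  then show ?thesis
    by (simp only: EQ_consistent.simps derives_Bot_iff)
qed

text \<open>The given set enters in two places only: the consistency test that selects the sets EQ,
  and the conjunction read at the modified valuation. Neither distinguishes \<open>X\<close> from
  its closure.\<close>

lemma sat_floor_expr_Cn:
  assumes "X \<subseteq> lang P"
  shows "sat_expr M (floor_expr P pr (Cn P X, U, V)) = sat_expr M (floor_expr P pr (X, U, V))"
  unfolding sat_floor_expr EQs_def EQ_consistent_Cn[OF assms] sat_Cn[OF assms] ..

theorem theorem10:
  fixes P :: "'a set" and pr :: "'a \<Rightarrow> 'a" and K \<alpha> :: "'a form"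
  assumes "inj_on pr P" and "pr ` P \<inter> P = {}"
    and "K \<in> lang P" and "\<alpha> \<in> lang P"
  shows "contraction P pr (Cn P {K}) \<alpha> = Cn_expr P (floor_expr P pr (Cn P {K}, {}, {Neg \<alpha>}))
    \<and> contraction P pr (Cn P {K}) \<alpha> = Cn_expr P (floor_expr P pr ({K}, {}, {Neg \<alpha>}))"
proof -
  have "contraction P pr (Cn P {K}) \<alpha> = Cn_expr P (floor_expr P pr (Cn P {K}, {}, {Neg \<alpha>}))"
    using assms(1,2) by (rule contraction_eq_floor) (auto simp: Cn_def)
  \<comment> \<open>\<open>Cn_expr\<close> sees an expression only through its models, so the two
    expressions need not coincide as sets.\<close>
  moreover have "Cn_expr P (floor_expr P pr (Cn P {K}, {}, {Neg \<alpha>})) =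
      Cn_expr P (floor_expr P pr ({K}, {}, {Neg \<alpha>}))"
    using assms(3) by (simp only: Cn_expr_def sat_floor_expr_Cn insert_subset empty_subsetI simp_thms)
  ultimately show ?thesis
    by simp
qed

end
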